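(* For any possibly randomized learner and any nonnegative integers $T_{\mathsf F},T_{\mathsf P}$ with $T=T_{\mathsf F}+T_{\mathsf P}>0$, there exists an instance of $T$-round online binary classification with the 0-1 target loss $\ell(\hat y,y)=\mathbb 1_{\hat y\ne y}$ and the smooth hinge surrogate loss, together with a comparator sequence $\boldsymbol U_1,\dots,\boldsymbol U_T\in\mathcal W$, such that $$\mathbb E\left[\sum_{t=1}^T\ell(\hat y_t,y_t)\right]\ge\frac T2,\qquad F_T\le3T_{\mathsf F},\qquad\text{and}\qquad P_T\le\sqrt2\,T_{\mathsf P},$$ where the expectation is taken over the learner's possible randomness, $F_T=\sum_{t=1}^TL_t(\boldsymbol U_t)$, and $P_T=\sum_{t=2}^T\|\boldsymbol U_t-\boldsymbol U_{t-1}\|_{\mathrm F}$. Consequently, for the same instance and comparator sequence, the expected cumulative target loss is $\Omega(F_T+P_T)$; that is, there is an absolute constant $c>0$ (independent of the learner, $T_{\mathsf F}$ and $T_{\mathsf P}$) with $\mathbb E[\sum_{t=1}^T\ell(\hat y_t,y_t)]\ge c\,(F_T+P_T)$.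
   Context: Online binary classification: labels and predictions both lie in $\{-1,+1\}$. An instance consists of an input dimension $m$, a closed convex set $\mathcal W\subseteq\mathbb R^{2\times m}$ of linear estimators with finite Frobenius-norm diameter, and a fixed sequence $(\boldsymbol x_t,y_t)_{t=1}^T$ with $\boldsymbol x_t\in\mathbb R^m$, $\|\boldsymbol x_t\|_2\le1$, $y_t\in\{-1,+1\}$. At each round $t=1,\dots,T$, the learner observes $\boldsymbol x_t$, outputs a prediction $\hat y_t\in\{-1,+1\}$, and then observes $y_t$. A (possibly randomized) learner is any rule that chooses $\hat y_t$ as a function of $\boldsymbol x_1,\dots,\boldsymbol x_t$, $y_1,\dots,y_{t-1}$ and internal randomness (it may also depend on $T$, $m$ and $\mathcal W$). The score vector of $\boldsymbol W$ is $\boldsymbol W\boldsymbol x_t\in\mathbb R^2$, its first coordinate corresponding to label $+1$ and its second to label $-1$. The smooth hinge surrogate loss at round $t$ is, with margin $\zeta=y_t\langle(+1,-1)^\top,\boldsymbol W\boldsymbol x_t\rangle$, $$L_t(\boldsymbol W)=\begin{cases}1-2\zeta&\text{if }\zeta\le0,\\ \max\{1-\zeta,0\}^2&\text{if }\zeta>0.\end{cases}$$ $\|\cdot\|_{\mathrm F}$ is the Frobenius norm. *)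

theory Defs
  imports
    "HOL-Probability.Probability"
    "Jordan_Normal_Form.Matrix"
begin

unbundle no vec_syntax
unbundle no inner_syntax

text \<open>
  The input dimension \<open>m\<close> is part of the instance and is chosen after the learner, so it cannot be
  a type. Vectors and matrices are therefore those of \<open>Jordan_Normal_Form\<close>, whose dimensions are
  values: \<open>carrier_vec m\<close> stands for \<open>\<real>\<^sup>m\<close> and \<open>carrier_mat 2 m\<close> for the real \<open>2 \<times> m\<close> matrices.
  Labels are the integers \<open>1\<close> and \<open>-1\<close>.
\<close>

definition euclid_norm :: "real vec \<Rightarrow> real" where
  "euclid_norm v = L2_set (\<lambda>i. v $ i) {..<dim_vec v}"

definition frob_norm :: "real mat \<Rightarrow> real" where
  "frob_norm A = L2_set (\<lambda>ij. A $$ ij) ({..<dim_row A} \<times> {..<dim_col A})"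

text \<open>
  The dimensions are arguments because \<open>Metric_space\<close> demands symmetry of the distance on the whole
  type, where \<open>frob_norm (A - B)\<close> is not symmetric for matrices of different dimensions.
\<close>

definition frob_dist :: "nat \<Rightarrow> nat \<Rightarrow> real mat \<Rightarrow> real mat \<Rightarrow> real" where
  "frob_dist r m A B = L2_set (\<lambda>ij. A $$ ij - B $$ ij) ({..<r} \<times> {..<m})"

lemma frob_dist_eq_norm:
  assumes "A \<in> carrier_mat r m" "B \<in> carrier_mat r m"
  shows "frob_dist r m A B = frob_norm (A - B)"
  using assms unfolding frob_dist_def frob_norm_def
  by (intro L2_set_cong) auto

lemma Metric_space_frob: "Metric_space (carrier_mat r m) (frob_dist r m)"
proof
  fix A B C :: "real mat"
  show "0 \<le> frob_dist r m A B"
    by (simp add: frob_dist_def)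
  show "frob_dist r m A B = frob_dist r m B A"
    by (simp add: frob_dist_def L2_set_def power2_commute)
  show "(frob_dist r m A B = 0) = (A = B)" if "A \<in> carrier_mat r m" "B \<in> carrier_mat r m"
    using that by (auto simp: frob_dist_def L2_set_eq_0_iff intro!: eq_matI)
  show "frob_dist r m A C \<le> frob_dist r m A B + frob_dist r m B C"
    using L2_set_triangle_ineq[of "\<lambda>ij. A $$ ij - B $$ ij" "\<lambda>ij. B $$ ij - C $$ ij"
        "{..<r} \<times> {..<m}"]
    by (simp add: frob_dist_def)
qed

definition estimator_set :: "nat \<Rightarrow> real mat set \<Rightarrow> bool" where
  "estimator_set m W \<longleftrightarrow>
     W \<subseteq> carrier_mat 2 m \<and>
     closedin (Metric_space.mtopology (carrier_mat 2 m) (frob_dist 2 m)) W \<and>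
     (\<forall>A\<in>W. \<forall>B\<in>W. \<forall>u\<ge>0. \<forall>v\<ge>0. u + v = 1 \<longrightarrow> u \<cdot>\<^sub>m A + v \<cdot>\<^sub>m B \<in> W) \<and>
     (\<exists>D. \<forall>A\<in>W. \<forall>B\<in>W. frob_norm (A - B) \<le> D)"

text \<open>Sequences are indexed by \<open>1, \<dots>, T\<close>; values at other indices are irrelevant.\<close>

definition online_instance ::
    "nat \<Rightarrow> nat \<Rightarrow> real mat set \<Rightarrow> (nat \<Rightarrow> real vec) \<Rightarrow> (nat \<Rightarrow> int) \<Rightarrow> bool" where
  "online_instance T m W x y \<longleftrightarrow>
     m > 0 \<and> estimator_set m W \<and>
     (\<forall>t\<in>{1..T}. x t \<in> carrier_vec m \<and> euclid_norm (x t) \<le> 1 \<and> y t \<in> {-1, 1})"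

text \<open>
  \<open>predict T m W xs ys \<omega>\<close> is the prediction after seeing the inputs \<open>xs\<close> (including the current one)
  and the earlier labels \<open>ys\<close>, where \<open>\<omega>\<close> is the internal randomness, drawn once from \<open>M\<close>.
  Measurability into \<open>count_space {-1, 1}\<close> also says that predictions are labels.
\<close>

locale online_learner = prob_space M for M :: "'w measure" +
  fixes predict :: "nat \<Rightarrow> nat \<Rightarrow> real mat set \<Rightarrow> real vec list \<Rightarrow> int list \<Rightarrow> 'w \<Rightarrow> int"
  assumes predict_measurable:
    "\<lbrakk>m > 0; estimator_set m W; length xs \<le> T; length xs = Suc (length ys);
      \<forall>x\<in>set xs. x \<in> carrier_vec m \<and> euclid_norm x \<le> 1; set ys \<subseteq> {-1, 1}\<rbrakk>
     \<Longrightarrow> predict T m W xs ys \<in> M \<rightarrow>\<^sub>M count_space {-1, 1}"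

definition prediction ::
    "(nat \<Rightarrow> nat \<Rightarrow> real mat set \<Rightarrow> real vec list \<Rightarrow> int list \<Rightarrow> 'w \<Rightarrow> int) \<Rightarrow>
     nat \<Rightarrow> nat \<Rightarrow> real mat set \<Rightarrow> (nat \<Rightarrow> real vec) \<Rightarrow> (nat \<Rightarrow> int) \<Rightarrow> nat \<Rightarrow> 'w \<Rightarrow> int" where
  "prediction predict T m W x y t = predict T m W (map x [1..<Suc t]) (map y [1..<t])"

definition zero_one_loss :: "int \<Rightarrow> int \<Rightarrow> real" where
  "zero_one_loss yhat y = (if yhat \<noteq> y then 1 else 0)"

definition expected_target_loss ::
    "'w measure \<Rightarrow> (nat \<Rightarrow> nat \<Rightarrow> real mat set \<Rightarrow> real vec list \<Rightarrow> int list \<Rightarrow> 'w \<Rightarrow> int) \<Rightarrow>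
     nat \<Rightarrow> nat \<Rightarrow> real mat set \<Rightarrow> (nat \<Rightarrow> real vec) \<Rightarrow> (nat \<Rightarrow> int) \<Rightarrow> real" where
  "expected_target_loss M predict T m W x y =
     (\<integral>\<omega>. (\<Sum>t=1..T. zero_one_loss (prediction predict T m W x y t \<omega>) (y t)) \<partial>M)"

definition margin :: "real mat \<Rightarrow> real vec \<Rightarrow> int \<Rightarrow> real" where
  "margin A x y = of_int y * (vec_of_list [1, -1] \<bullet> (A *\<^sub>v x))"

definition smooth_hinge :: "real \<Rightarrow> real" where
  "smooth_hinge z = (if z \<le> 0 then 1 - 2 * z else (max (1 - z) 0)\<^sup>2)"

definition surrogate_loss :: "real mat \<Rightarrow> real vec \<Rightarrow> int \<Rightarrow> real" where
  "surrogate_loss A x y = smooth_hinge (margin A x y)"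

definition comparator_loss ::
    "nat \<Rightarrow> (nat \<Rightarrow> real vec) \<Rightarrow> (nat \<Rightarrow> int) \<Rightarrow> (nat \<Rightarrow> real mat) \<Rightarrow> real" where
  "comparator_loss T x y U = (\<Sum>t=1..T. surrogate_loss (U t) (x t) (y t))"

definition path_length :: "nat \<Rightarrow> (nat \<Rightarrow> real mat) \<Rightarrow> real" where
  "path_length T U = (\<Sum>t=2..T. frob_norm (U t - U (t - 1)))"

end

theory Submission
  imports Defs
begin

text \<open>
  The inputs are constantly \<open>1 \<in> \<real>\<^sup>1\<close>, so the learner faces guessing each label from the earlier
  ones, and a label that it misses with probability at least \<open>1/2\<close> can be chosen round by round. The
  estimators \<open>\<plusminus>(1/2, -1/2)\<close> have margin \<open>\<plusminus>y\<close>, hence loss \<open>0\<close> or \<open>3\<close>, and lie at distance \<open>\<surd>2\<close>.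
  The comparator stays put in the first \<open>T\<^sub>F\<close> rounds, paying at most \<open>3\<close> each, and then follows the
  labels, paying no loss and at most \<open>\<surd>2\<close> of path length per round.
\<close>

text \<open>Metric balls are closed in the induced topology. Convexity comes from homogeneity and
  the triangle inequality of \<open>L2_set\<close>, and going through the centre bounds the diameter
  by \<open>2 * r\<close>.\<close>

lemma estimator_set_mcball:
  "estimator_set m (Metric_space.mcball (carrier_mat 2 m) (frob_dist 2 m) (0\<^sub>m 2 m) r)"
proof -
  interpret Metric_space "carrier_mat 2 m" "frob_dist 2 m"
    by (rule Metric_space_frob)
  let ?I = "{..<2::nat} \<times> {..<m}" and ?O = "0\<^sub>m 2 m :: real mat"
  have zero: "frob_dist 2 m ?O A = L2_set (\<lambda>ij. A $$ ij) ?I" for A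
    unfolding frob_dist_def L2_set_def
    by (intro arg_cong[where f = sqrt] sum.cong) auto
  have convex: "u \<cdot>\<^sub>m A + v \<cdot>\<^sub>m B \<in> mcball ?O r"
    if A: "A \<in> mcball ?O r" and B: "B \<in> mcball ?O r" and uv: "u \<ge> 0" "v \<ge> 0" "u + v = 1"
    for A B and u v :: real
  proof -
    have carr: "A \<in> carrier_mat 2 m" "B \<in> carrier_mat 2 m"
      using A B by auto
    have "frob_dist 2 m ?O (u \<cdot>\<^sub>m A + v \<cdot>\<^sub>m B)
        = L2_set (\<lambda>ij. u * A $$ ij + v * B $$ ij) ?I"
      unfolding zero using carr by (intro L2_set_cong) auto
    also have "\<dots> \<le> u * L2_set (\<lambda>ij. A $$ ij) ?I + v * L2_set (\<lambda>ij. B $$ ij) ?I"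
      using L2_set_triangle_ineq[of "\<lambda>ij. u * A $$ ij" "\<lambda>ij. v * B $$ ij" ?I] uv
      by (simp add: L2_set_right_distrib)
    also have "\<dots> \<le> u * r + v * r"
      using A B uv by (intro add_mono mult_left_mono) (auto simp: zero[symmetric])
    also have "\<dots> = r"
      using uv by (simp flip: distrib_right)
    finally show ?thesis
      using carr by simp
  qed
  have "frob_norm (A - B) \<le> 2 * r" if "A \<in> mcball ?O r" "B \<in> mcball ?O r" for A B
    using that triangle[of A ?O B] commute[of A ?O]
    by (simp add: frob_dist_eq_norm[of A 2 m B, symmetric])
  then show ?thesis
    unfolding estimator_set_def
    using convex closedin_mcball mcball_subset_mspace by blast
qed

text \<open>The equation refers to all earlier values at once, so the recursion is run on the
  growing list of values instead. It supplies an adversary whose labels react to their own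
  past.\<close>

lemma exists_history_dependent_sequence:
  fixes f :: "'a list \<Rightarrow> 'a"
  obtains y :: "nat \<Rightarrow> 'a" where "\<And>t. t \<ge> 1 \<Longrightarrow> y t = f (map y [1..<t])"
proof -
  define ys where "ys = rec_nat [] (\<lambda>_ l. l @ [f l])"
  \<comment> \<open>\<open>ys n\<close> collects the values at indices \<open>1\<close> to
    \<open>n\<close>, so index \<open>t\<close> reads \<open>ys (t - 1)\<close>. The value at
    \<open>0\<close> is arbitrary.\<close>
  define y where "y t = f (ys (t - 1))" for t
  have Suc: "ys (Suc n) = ys n @ [y (Suc n)]" and zero: "ys 0 = []" for n
    by (simp_all add: ys_def y_def)
  have history: "map y [1..<Suc n] = ys n" for n
    by (induction n) (simp_all add: zero Suc)
  have "y t = f (map y [1..<t])" if "t \<ge> 1" for t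
  proof -
    have "Suc (t - 1) = t"
      using that by simp
    then have "map y [1..<t] = ys (t - 1)"
      using history[of "t - 1"] by argo
    then show ?thesis
      by (simp only: y_def[of t])
  qed
  then show thesis
    by (rule that)
qed

text \<open>A prediction in \<open>{-1, 1}\<close> differs from exactly one of the two labels, so
  the losses add up to 1 pointwise. Hence one of the labels costs at least \<open>1/2\<close> in
  expectation.\<close>

lemma (in prob_space)
  fixes h :: "'a \<Rightarrow> int"
  assumes h: "h \<in> M \<rightarrow>\<^sub>M count_space {-1, 1}"
  shows integrable_zero_one_loss: "integrable M (\<lambda>\<omega>. zero_one_loss (h \<omega>) k)"
    and expected_losses_sum_1:
      "expectation (\<lambda>\<omega>. zero_one_loss (h \<omega>) 1) + expectation (\<lambda>\<omega>. zero_one_loss (h \<omega>) (-1)) = 1"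
proof -
  have int: "integrable M (\<lambda>\<omega>. zero_one_loss (h \<omega>) k)" for k
  proof (rule integrable_const_bound[where B = 1])
    show "(\<lambda>\<omega>. zero_one_loss (h \<omega>) k) \<in> borel_measurable M"
      by (rule measurable_compose[OF h]) simp
  qed (simp add: zero_one_loss_def)
  show "integrable M (\<lambda>\<omega>. zero_one_loss (h \<omega>) k)"
    by (rule int)
  have "expectation (\<lambda>\<omega>. zero_one_loss (h \<omega>) 1) + expectation (\<lambda>\<omega>. zero_one_loss (h \<omega>) (-1))
      = expectation (\<lambda>\<omega>. zero_one_loss (h \<omega>) 1 + zero_one_loss (h \<omega>) (-1))"
    using int by simp
  also have "\<dots> = expectation (\<lambda>_. 1)"
    using measurable_space[OF h]
    by (intro Bochner_Integration.integral_cong) (auto simp: zero_one_loss_def)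
  finally show "expectation (\<lambda>\<omega>. zero_one_loss (h \<omega>) 1)
      + expectation (\<lambda>\<omega>. zero_one_loss (h \<omega>) (-1)) = 1"
    by (simp add: prob_space)
qed

text \<open>The loss of a round depends only on its label and the earlier ones, so a greedy choice
  works round by round. It consults the distribution of the prediction, never its realisation, which
  keeps \<open>y\<close> a fixed sequence. Linearity of expectation adds up the rounds.\<close>

lemma (in online_learner) exists_hard_labels:
  assumes "m > 0" "estimator_set m W"
    and x: "\<forall>t\<in>{1..T}. x t \<in> carrier_vec m \<and> euclid_norm (x t) \<le> 1"
  obtains y :: "nat \<Rightarrow> int" where "\<And>t. t \<ge> 1 \<Longrightarrow> y t \<in> {-1, 1}"
    and "expected_target_loss M predict T m W x y \<ge> real T / 2"
proof -
  \<comment> \<open>A history \<open>l\<close> identifies the current round as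
    \<open>length l + 1\<close>, whose input is already visible; the upper end of the interval is
    exclusive.\<close>
  define h where "h l = predict T m W (map x [1..<Suc (Suc (length l))]) l" for l
  define L where "L l k = expectation (\<lambda>\<omega>. zero_one_loss (h l \<omega>) k)" for l k
  obtain y :: "nat \<Rightarrow> int"
    where y: "\<And>t. t \<ge> 1 \<Longrightarrow> y t =
      (if L (map y [1..<t]) 1 \<ge> 1/2 then 1 else -1)"
    using exists_history_dependent_sequence[of "\<lambda>l. if L l 1 \<ge> 1/2 then 1 else -1"] by metis
  have label: "y t \<in> {-1, 1}" if "t \<ge> 1" for t
    using y[OF that] by simp
  have pred: "prediction predict T m W x y t = h (map y [1..<t])" if "t \<in> {1..T}" for t
    using that by (simp add: prediction_def h_def)
  have meas: "h (map y [1..<t]) \<in> M \<rightarrow>\<^sub>M count_space {-1, 1}" if "t \<in> {1..T}" for t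
    unfolding h_def
  proof (intro predict_measurable ballI subsetI)
    show "z \<in> carrier_vec m \<and> euclid_norm z \<le> 1"
      if "z \<in> set (map x [1..<Suc (Suc (length (map y [1..<t])))])" for z
      using that x \<open>t \<in> {1..T}\<close> by (auto simp del: upt_Suc)
    show "k \<in> {-1, 1}" if k: "k \<in> set (map y [1..<t])" for k
    proof -
      obtain i where "k = y i" "i \<ge> 1"
        using k by auto
      then show ?thesis
        using label by metis
    qed
  qed (use that assms in auto)
  \<comment> \<open>If label \<open>1\<close> costs less than \<open>1/2\<close>, then
    \<open>-1\<close> costs more, as the two costs sum to 1.\<close>
  have round: "L (map y [1..<t]) (y t) \<ge> 1/2" if "t \<in> {1..T}" for t
    using y[of t] that expected_losses_sum_1[OF meas[OF that]]
    by (auto simp: L_def)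
  have "real T / 2 = (\<Sum>t=1..T. 1/2)"
    by simp
  also have "\<dots> \<le> (\<Sum>t=1..T. L (map y [1..<t]) (y t))"
    by (intro sum_mono round)
  also have "\<dots> = expectation (\<lambda>\<omega>. \<Sum>t=1..T. zero_one_loss (h (map y [1..<t]) \<omega>) (y t))"
    unfolding L_def
    by (intro Bochner_Integration.integral_sum[symmetric] integrable_zero_one_loss meas)
  also have "\<dots> = expected_target_loss M predict T m W x y"
    unfolding expected_target_loss_def
    by (intro Bochner_Integration.integral_cong sum.cong) (simp_all add: pred)
  finally show thesis
    using label that by blast
qed

text \<open>The factor \<open>1/2\<close> makes the two scores differ by exactly \<open>k\<close> at
  input 1. Keeping \<open>k\<close> as a linear factor gives distances and margins for all integers
  without a case split.\<close>

definition label_estimator :: "int \<Rightarrow> real mat" where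
  "label_estimator k = mat 2 1 (\<lambda>(i, j). of_int k * (if i = 0 then 1/2 else - 1/2))"

lemma lessThan_2_times_1: "{..<2::nat} \<times> {..<1::nat} = {(0, 0), (1, 0)}"
  by auto

lemma label_estimator_carrier: "label_estimator k \<in> carrier_mat 2 1"
  by (simp add: label_estimator_def)

lemma frob_norm_diff_label_estimator:
  "frob_norm (label_estimator k - label_estimator l) = \<bar>of_int (k - l)\<bar> / sqrt 2"
proof -
  have "frob_norm (label_estimator k - label_estimator l) = sqrt ((of_int (k - l))\<^sup>2 / 2)"
    unfolding frob_dist_eq_norm[OF label_estimator_carrier label_estimator_carrier, symmetric]
      frob_dist_def L2_set_def lessThan_2_times_1
    by (simp add: label_estimator_def power2_eq_square algebra_simps)
  then show ?thesis
    by (simp add: real_sqrt_divide)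
qed

lemma label_estimator_in_mcball:
  assumes "k \<in> {-1, 1}"
  shows "label_estimator k \<in> Metric_space.mcball (carrier_mat 2 1) (frob_dist 2 1) (0\<^sub>m 2 1) 1"
proof -
  have "frob_dist 2 1 (0\<^sub>m 2 1) (label_estimator k) = sqrt (1/2)"
    using assms unfolding frob_dist_def L2_set_def lessThan_2_times_1
    by (auto simp: label_estimator_def power2_eq_square)
  moreover have "sqrt (1/2) \<le> (1::real)"
    by simp
  ultimately show ?thesis
    using label_estimator_carrier by (simp add: Metric_space.in_mcball[OF Metric_space_frob])
qed

lemma margin_label_estimator:
  "margin (label_estimator k) (vec 1 (\<lambda>_. 1)) y = of_int (y * k)"
  by (simp add: margin_def label_estimator_def scalar_prod_def numeral_2_eq_2)

theorem theorem5p1: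
  shows "\<exists>c::real. c > 0 \<and>
    (\<forall>(M :: 'w measure) predict (T\<^sub>F :: nat) (T\<^sub>P :: nat) (T :: nat).
       online_learner M predict \<longrightarrow> T = T\<^sub>F + T\<^sub>P \<longrightarrow> T > 0 \<longrightarrow>
       (\<exists>m W x y U.
          online_instance T m W x y \<and>
          (\<forall>t\<in>{1..T}. U t \<in> W) \<and>
          expected_target_loss M predict T m W x y \<ge> real T / 2 \<and>
          comparator_loss T x y U \<le> 3 * real T\<^sub>F \<and>
          path_length T U \<le> sqrt 2 * real T\<^sub>P \<and>
          expected_target_loss M predict T m W x y
            \<ge> c * (comparator_loss T x y U + path_length T U)))"
\<comment> \<open>Both budgets cost at most 3 per round, so their sum is at most
  \<open>3 * T\<close>, six times the guaranteed loss \<open>T / 2\<close>.\<close>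
proof (intro exI[of _ "1/6"] conjI allI impI)
  fix M :: "'w measure" and predict and T\<^sub>F T\<^sub>P T :: nat
  assume "online_learner M predict" and T: "T = T\<^sub>F + T\<^sub>P"
  then interpret online_learner M predict
    by simp
  \<comment> \<open>The learner may depend on \<open>W\<close>, so it is fixed before the labels.
    Radius 1 leaves room for both label estimators, whose norm is \<open>sqrt (1/2)\<close>.\<close>
  define W where "W = Metric_space.mcball (carrier_mat 2 1) (frob_dist 2 1) (0\<^sub>m 2 1) 1"
  define x :: "nat \<Rightarrow> real vec" where "x = (\<lambda>_. vec 1 (\<lambda>_. 1))"
  have W: "estimator_set 1 W"
    unfolding W_def by (rule estimator_set_mcball)
  have x: "\<forall>t\<in>{1..T}. x t \<in> carrier_vec 1 \<and> euclid_norm (x t) \<le> 1"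
    by (simp add: x_def euclid_norm_def L2_set_def)
  obtain y :: "nat \<Rightarrow> int" where y: "\<And>t. t \<ge> 1 \<Longrightarrow> y t \<in> {-1, 1}"
    and hard: "expected_target_loss M predict T 1 W x y \<ge> real T / 2"
    using exists_hard_labels[of 1 W T x] W x by force
  define k where "k t = (if t \<le> T\<^sub>F then 1 else y t)" for t
  define U where "U t = label_estimator (k t)" for t
  have k: "k t \<in> {-1, 1}" if "t \<ge> 1" for t
    using y[OF that] by (auto simp: k_def)
  have UW: "U t \<in> W" if "t \<ge> 1" for t
    unfolding U_def W_def using k[OF that] by (rule label_estimator_in_mcball)
  \<comment> \<open>The margin \<open>y t * k t\<close> is \<open>1\<close> or \<open>-1\<close>,
    with loss 0 or 3; after round \<open>T\<^sub>F\<close> it is the square of a label, hence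
    1.\<close>
  have "surrogate_loss (U t) (x t) (y t) \<le> (if t \<le> T\<^sub>F then 3 else 0)" if "t \<in> {1..T}" for t
  proof -
    have "surrogate_loss (U t) (x t) (y t) = smooth_hinge (of_int (y t * k t))"
      by (simp only: surrogate_loss_def U_def x_def margin_label_estimator)
    then show ?thesis
      using y[of t] that by (auto simp: smooth_hinge_def k_def)
  qed
  then have "comparator_loss T x y U \<le> (\<Sum>t=1..T. if t \<le> T\<^sub>F then 3 else 0)"
    unfolding comparator_loss_def by (rule sum_mono)
  also have "\<dots> = 3 * real (card {t \<in> {1..T}. t \<le> T\<^sub>F})"
    by (simp flip: sum.inter_filter)
  also have "{t \<in> {1..T}. t \<le> T\<^sub>F} = {1..T\<^sub>F}"
    using T by auto
  finally have F: "comparator_loss T x y U \<le> 3 * real T\<^sub>F"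
    by simp
  \<comment> \<open>The move from round \<open>T\<^sub>F\<close> to the next is charged to the
    second phase, so the first phase costs no path length.\<close>
  have "frob_norm (U t - U (t - 1)) \<le> (if t \<le> T\<^sub>F then 0 else sqrt 2)" if "t \<in> {2..T}" for t
  proof (cases "t \<le> T\<^sub>F")
    case True
    then have "t - 1 \<le> T\<^sub>F"
      by simp
    with True show ?thesis
      by (simp add: U_def k_def frob_norm_diff_label_estimator)
  next
    case False
    have "k t \<in> {-1, 1}" "k (t - 1) \<in> {-1, 1}"
      using that by (auto intro!: k simp del: insert_iff)
    then have "\<bar>k t - k (t - 1)\<bar> \<le> 2"
      by auto
    then have "\<bar>of_int (k t - k (t - 1))\<bar> \<le> (2::real)"
      by linarith
    then have "frob_norm (U t - U (t - 1)) \<le> 2 / sqrt 2"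
      unfolding U_def frob_norm_diff_label_estimator by (intro divide_right_mono) auto
    then show ?thesis
      using False by (simp add: real_div_sqrt)
  qed
  then have "path_length T U \<le> (\<Sum>t=2..T. if t \<le> T\<^sub>F then 0 else sqrt 2)"
    unfolding path_length_def by (rule sum_mono)
  also have "\<dots> = (\<Sum>t | t \<in> {2..T} \<and> T\<^sub>F < t. sqrt 2)"
    by (subst sum.inter_filter) (auto intro!: sum.cong)
  \<comment> \<open>Only an inequality: for \<open>T\<^sub>F = 0\<close> the right-hand side also
    counts \<open>t = 1\<close>, where no move takes place.\<close>
  also have "\<dots> \<le> (\<Sum>t\<in>{T\<^sub>F<..T}. sqrt 2)"
    by (rule sum_mono2) auto
  finally have P: "path_length T U \<le> sqrt 2 * real T\<^sub>P"
    using T by (simp add: mult.commute)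
  have "sqrt 2 \<le> (3::real)"
    by (rule real_le_lsqrt) auto
  then have "sqrt 2 * real T\<^sub>P \<le> 3 * real T\<^sub>P"
    by (rule mult_right_mono) simp
  then have sum: "1/6 * (comparator_loss T x y U + path_length T U)
      \<le> expected_target_loss M predict T 1 W x y"
    using F P hard T by simp
  have "online_instance T 1 W x y"
    using W x y by (simp add: online_instance_def)
  then show "\<exists>m W x y U.
      online_instance T m W x y \<and>
      (\<forall>t\<in>{1..T}. U t \<in> W) \<and>
      expected_target_loss M predict T m W x y \<ge> real T / 2 \<and>
      comparator_loss T x y U \<le> 3 * real T\<^sub>F \<and>
      path_length T U \<le> sqrt 2 * real T\<^sub>P \<and>
      expected_target_loss M predict T m W x y
        \<ge> 1/6 * (comparator_loss T x y U + path_length T U)"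
    using UW hard F P sum by (metis atLeastAtMost_iff)
qed simp

end
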